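(* Let $f(\alpha;q)=\sum_{n=0}^\infty \frac{q^{n^2-n}\alpha^n}{(-q;q)_n(-\alpha;q)_n}$, and let $P_{do}$ denote the set of partitions into distinct parts with the smallest part being odd. Then \[ (-\alpha q;q)_\infty\, f(\alpha q;q)=1+2\sum_{\nu \in P_{do}}\alpha^{l(\nu)}q^{|\nu|}. \]
   Context: Notation: $(a;q)_n=(1-a)(1-aq)\cdots(1-aq^{n-1})$, $(a;q)_\infty=\prod_{n\ge0}(1-aq^n)$; identities of formal power series in $q$. For a partition $\nu$, $|\nu|$ is the sum of its parts and $l(\nu)$ its number of parts. *)

theory Defs
  imports "HOL-Analysis.Analysis" "HOL-Library.Multiset"
    "HOL-Computational_Algebra.Formal_Power_Series"
begin

definition qpoch :: "'a::comm_ring_1 \<Rightarrow> 'a \<Rightarrow> nat \<Rightarrow> 'a" where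
  "qpoch a q n = (\<Prod>k<n. 1 - a * q ^ k)"

definition qpoch_inf :: "'a::{comm_ring_1, t2_space} \<Rightarrow> 'a \<Rightarrow> 'a" where
  "qpoch_inf a q = prodinf (\<lambda>n. 1 - a * q ^ n)"

(* Arguments are formal power series, so that alpha may itself involve the variable, as in
   f(alpha q; q).  Infinite sums and products are limits in the library's metric on 'a fps,
   i.e. coefficientwise stabilisation.  Division is ordinary multiplication by the inverse
   as long as q has constant coefficient 0 and alpha does not have constant coefficient -1,
   since the denominators then have nonzero constant coefficients. *)
definition f_series :: "'a::field fps \<Rightarrow> 'a fps \<Rightarrow> 'a fps" where
  "f_series \<alpha> q =
     (\<Sum>n. q ^ (n\<^sup>2 - n) * \<alpha> ^ n / (qpoch (- q) q n * qpoch (- \<alpha>) q n))"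

(* A partition is the multiset of its (positive) parts: |nu| is sum_mset nu, l(nu) is size nu. *)
definition is_partition :: "nat multiset \<Rightarrow> bool" where
  "is_partition \<nu> \<longleftrightarrow> (\<forall>i \<in># \<nu>. 0 < i)"

(* The empty partition has no smallest part and is excluded; on the right-hand side of the
   identity it is accounted for by the constant term 1. *)
definition P_do :: "nat multiset set" where
  "P_do = {\<nu>. is_partition \<nu> \<and> (\<forall>i. count \<nu> i \<le> 1) \<and> \<nu> \<noteq> {#} \<and> odd (Min (set_mset \<nu>))}"

end

theory Submission
  imports Defs
begin

text \<open>
  Write \<open>L(a)\<close> for the sum over n of \<open>q^(n^2) a^n (-a q^(n+1); q)_\<infinity> / (-q; q)_n\<close>, so that the
  left-hand side of the identity is \<open>L(\<alpha>)\<close>. The terms of \<open>L(a) - L(a q^2)\<close> telescope, giving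
  \<open>L(a) - L(a q^2) = 2 a q (-a q^2; q)_\<infinity>\<close>. Iterating, and since \<open>L(a q^(2J))\<close> tends to 1,
  \<open>L(\<alpha>)\<close> is 1 plus twice the sum of \<open>\<alpha> q^k (-\<alpha> q^(k+1); q)_\<infinity>\<close> over odd k, and the summand for k
  counts the partitions into distinct parts with smallest part k. All limits are taken as
  congruences modulo powers of the variable.
\<close>

section \<open>Congruences modulo powers of the variable\<close>

lemma fps_X_power_dvd_iff:
  fixes f :: "'a::comm_ring_1 fps"
  shows "fps_X ^ N dvd f \<longleftrightarrow> (\<forall>i<N. fps_nth f i = 0)"
proof
  assume "\<forall>i<N. fps_nth f i = 0"
  then have "f = fps_X ^ N * fps_shift N f"
    by (auto simp: fps_eq_iff fps_X_power_mult_nth)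
  then show "fps_X ^ N dvd f"
    by (metis dvd_triv_left)
qed (auto simp: fps_X_power_mult_nth elim!: dvdE)

lemma fps_nth_eq_of_dvd_diff:
  fixes f g :: "'a::comm_ring_1 fps"
  assumes "fps_X ^ N dvd f - g" "i < N"
  shows "fps_nth f i = fps_nth g i"
  using assms by (auto simp: fps_X_power_dvd_iff)

lemma fps_eq_of_dvd_diff:
  fixes f g :: "'a::comm_ring_1 fps"
  assumes "\<And>N. fps_X ^ N dvd f - g"
  shows "f = g"
  using fps_nth_eq_of_dvd_diff[OF assms] by (meson fps_eq_iff lessI)

lemma dvd_diff_trans:
  fixes d f g h :: "'a::comm_ring_1"
  assumes "d dvd f - g" "d dvd g - h"
  shows "d dvd f - h"
  using dvd_add[OF assms] by simp

lemma dvd_diff_mult: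
  fixes d f g f' g' :: "'a::comm_ring_1"
  assumes "d dvd f - g" "d dvd f' - g'"
  shows "d dvd f * f' - g * g'"
proof -
  have "f * f' - g * g' = (f - g) * f' + g * (f' - g')"
    by (simp add: algebra_simps)
  then show ?thesis
    using assms by simp
qed

text \<open>Coefficient \<open>m\<close> receives nothing from terms with index above
  \<open>m\<close>, so the partial sums stabilise coefficientwise. This also yields the convergence
  that \<open>suminf\<close> presupposes.\<close>

lemma fps_X_power_dvd_suminf_diff:
  fixes f :: "nat \<Rightarrow> 'a::comm_ring_1 fps"
  assumes "\<And>n. fps_X ^ n dvd f n"
  shows "fps_X ^ N dvd suminf f - (\<Sum>n<N. f n)"
proof -
  define S where "S = Abs_fps (\<lambda>m. fps_nth (\<Sum>n<Suc m. f n) m)"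
  have zero: "fps_nth (f n) m = 0" if "m < n" for m n
    using assms[of n] that by (auto simp: fps_X_power_dvd_iff)
  have part: "fps_nth (\<Sum>n<K. f n) m = fps_nth S m" if "m < K" for m K
  proof -
    have "(\<Sum>n<K. fps_nth (f n) m) = (\<Sum>n<Suc m. fps_nth (f n) m)"
      using that by (intro sum.mono_neutral_right) (auto simp: zero)
    then show ?thesis
      by (simp add: S_def fps_sum_nth del: sum.lessThan_Suc)
  qed
  have "(\<lambda>K. \<Sum>n<K. f n) \<longlonglongrightarrow> S"
    by (rule tendsto_fpsI, rule eventually_mono[OF eventually_gt_at_top], rule part)
  then have "suminf f = S"
    by (simp add: sums_def sums_unique[symmetric])
  then show ?thesis
    by (simp add: fps_X_power_dvd_iff part)
qed

text \<open>Every finite set between \<open>B m\<close> and \<open>A\<close> gives the same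
  coefficient \<open>m\<close>, so the net of finite partial sums stabilises
  coefficientwise.\<close>

lemma fps_nth_infsum:
  fixes f :: "'b \<Rightarrow> 'a::comm_ring_1 fps"
  assumes "\<And>m. finite (B m)" "\<And>m. B m \<subseteq> A"
    and "\<And>m x. x \<in> A - B m \<Longrightarrow> fps_nth (f x) m = 0"
  shows "fps_nth (infsum f A) m = (\<Sum>x\<in>B m. fps_nth (f x) m)"
proof -
  define S where "S = Abs_fps (\<lambda>m. \<Sum>x\<in>B m. fps_nth (f x) m)"
  have "(f has_sum S) A"
    unfolding has_sum_def
  proof (rule tendsto_fpsI)
    fix m
    have "fps_nth (sum f Y) m = fps_nth S m" if "finite Y" "B m \<subseteq> Y" "Y \<subseteq> A" for Y
      unfolding fps_sum_nth S_def fps_nth_Abs_fps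
      using that assms(3) by (intro sum.mono_neutral_right) auto
    then show "\<forall>\<^sub>F Y in finite_subsets_at_top A. fps_nth (sum f Y) m = fps_nth S m"
      unfolding eventually_finite_subsets_at_top
      using assms(1,2) by (intro exI[of _ "B m"]) simp
  qed
  then show ?thesis
    by (simp add: infsumI S_def)
qed

section \<open>Infinite q-Pochhammer symbols\<close>

lemma fps_nth_0_prod_one_add:
  fixes a :: "'a::comm_ring_1 fps"
  assumes "fps_nth a 0 = 0"
  shows "fps_nth (\<Prod>i<n. 1 + a * fps_X ^ i) 0 = 1"
  using assms by (induction n) auto

text \<open>Factors with index at least \<open>N\<close> are 1 modulo \<open>fps_X ^ N\<close>, so
  the finite products stabilise.\<close>

lemma qpoch_inf_dvd_diff:
  fixes a :: "'a::field fps"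
  assumes "fps_nth a 0 = 0"
  shows "fps_X ^ N dvd qpoch_inf (- a) fps_X - (\<Prod>i<N. 1 + a * fps_X ^ i)"
proof -
  define Q where "Q n = (\<Prod>i<n. 1 + a * fps_X ^ i)" for n
  define P where "P = Abs_fps (\<lambda>m. fps_nth (Q (Suc m)) m)"
  have step: "fps_X ^ N dvd Q n - Q N" if "N \<le> n" for n N
    using that
  proof (induction n rule: dec_induct)
    case (step n)
    have "fps_X ^ N dvd Q (Suc n) - Q n"
      using step(1) by (simp add: Q_def algebra_simps le_imp_power_dvd dvd_mult)
    then show ?case
      using step.IH dvd_diff_trans by blast
  qed simp
  have part: "fps_nth (Q K) m = fps_nth P m" if "m < K" for m K
    using fps_nth_eq_of_dvd_diff[OF step[of "Suc m" K], of m] that by (simp add: P_def)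
  have "Q \<longlonglongrightarrow> P"
    by (rule tendsto_fpsI, rule eventually_mono[OF eventually_gt_at_top], rule part)
  then have "(\<lambda>n. \<Prod>i\<le>n. 1 + a * fps_X ^ i) \<longlonglongrightarrow> P"
    unfolding Q_def using LIMSEQ_lessThan_iff_atMost by blast
  \<comment> \<open>\<open>raw_has_prod\<close> demands a nonzero limit; the constant coefficient 1
    provides it.\<close>
  moreover have "fps_nth P 0 = 1"
    using assms by (simp add: P_def Q_def)
  then have "P \<noteq> 0"
    by (metis fps_zero_nth zero_neq_one[where 'a = 'a])
  ultimately have "(\<lambda>i. 1 + a * fps_X ^ i) has_prod P"
    by (simp add: has_prod_def raw_has_prod_def)
  then have "qpoch_inf (- a) fps_X = P"
    by (simp add: qpoch_inf_def has_prod_unique[symmetric])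
  then show ?thesis
    using part by (simp add: fps_X_power_dvd_iff Q_def)
qed

lemma qpoch_inf_rec:
  fixes a :: "'a::field fps"
  assumes "fps_nth a 0 = 0"
  shows "qpoch_inf (- a) fps_X = (1 + a) * qpoch_inf (- (a * fps_X)) fps_X"
proof (rule fps_eq_of_dvd_diff)
  fix N
  \<comment> \<open>With \<open>Suc N\<close> factors, exactly \<open>N\<close> remain once the
    first factor \<open>1 + a\<close> is split off.\<close>
  have "fps_X ^ Suc N dvd qpoch_inf (- a) fps_X - (\<Prod>i<Suc N. 1 + a * fps_X ^ i)"
    by (rule qpoch_inf_dvd_diff[OF assms])
  then have "fps_X ^ N dvd qpoch_inf (- a) fps_X - (\<Prod>i<Suc N. 1 + a * fps_X ^ i)"
    by (rule power_le_dvd) simp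
  moreover have "(\<Prod>i<Suc N. 1 + a * fps_X ^ i)
      = (1 + a) * (\<Prod>i<N. 1 + a * fps_X * fps_X ^ i)"
    by (simp add: prod.lessThan_Suc_shift mult.assoc del: prod.lessThan_Suc)
  ultimately have "fps_X ^ N dvd
      qpoch_inf (- a) fps_X - (1 + a) * (\<Prod>i<N. 1 + a * fps_X * fps_X ^ i)"
    by simp
  moreover have "fps_X ^ N dvd (1 + a) * (\<Prod>i<N. 1 + a * fps_X * fps_X ^ i)
      - (1 + a) * qpoch_inf (- (a * fps_X)) fps_X"
    using qpoch_inf_dvd_diff[of "a * fps_X" N]
    by (intro dvd_diff_mult) (simp_all add: dvd_diff_commute)
  ultimately show "fps_X ^ N dvd
      qpoch_inf (- a) fps_X - (1 + a) * qpoch_inf (- (a * fps_X)) fps_X"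
    by (rule dvd_diff_trans)
qed

lemma qpoch_inf_split:
  fixes a :: "'a::field fps"
  assumes "fps_nth a 0 = 0"
  shows "qpoch_inf (- a) fps_X = qpoch (- a) fps_X n * qpoch_inf (- (a * fps_X ^ n)) fps_X"
proof (induction n)
  case (Suc n)
  then show ?case
    using assms qpoch_inf_rec[of "a * fps_X ^ n"] by (simp add: qpoch_def mult_ac)
qed (simp add: qpoch_def)

lemma qpoch_inf_dvd_diff_one:
  fixes a :: "'a::field fps"
  assumes "fps_X ^ N dvd a" "0 < N"
  shows "fps_X ^ N dvd qpoch_inf (- a) fps_X - 1"
proof -
  have "fps_X ^ N dvd (\<Prod>i<n. 1 + a * fps_X ^ i) - 1" for n
  proof (induction n)
    case (Suc n)
    have "fps_X ^ N dvd (1 + a * fps_X ^ n) - 1"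
      using assms(1) by simp
    from dvd_diff_mult[OF Suc this] show ?case
      by simp
  qed simp
  moreover have "fps_nth a 0 = 0"
    using assms by (auto simp: fps_X_power_dvd_iff)
  ultimately show ?thesis
    using qpoch_inf_dvd_diff dvd_diff_trans by blast
qed

section \<open>The telescoping functional equation\<close>

lemma qpoch_neg_X_nth_0: "fps_nth (qpoch (- fps_X) (fps_X :: 'a::field fps) n) 0 = 1"
  using fps_nth_0_prod_one_add[of "fps_X :: 'a fps" n] by (simp add: qpoch_def)

text \<open>Brings \<open>f_cert a (Suc n)\<close> over the denominator of
  \<open>f_term a n\<close>.\<close>

lemma inverse_qpoch_neg_X_Suc:
  "inverse (qpoch (- fps_X) (fps_X :: 'a::field fps) n)
     = (1 + fps_X ^ Suc n) * inverse (qpoch (- fps_X) fps_X (Suc n))"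
proof -
  let ?D = "qpoch (- fps_X) (fps_X :: 'a fps)"
  have D: "?D n * inverse (?D n) = 1" "?D (Suc n) * inverse (?D (Suc n)) = 1"
    by (simp_all add: inverse_mult_eq_1' qpoch_neg_X_nth_0)
  have "?D (Suc n) = ?D n * (1 + fps_X ^ Suc n)"
    by (simp add: qpoch_def)
  then have "inverse (?D n) = inverse (?D n) * (?D n * (1 + fps_X ^ Suc n) * inverse (?D (Suc n)))"
    using D(2) by simp
  also have "\<dots> = (1 + fps_X ^ Suc n) * inverse (?D (Suc n)) * (?D n * inverse (?D n))"
    by (simp only: mult_ac)
  finally show ?thesis
    by (simp only: D(1) mult_1_right)
qed

text \<open>The n-th term of f(aq;q) times (-aq;q)_\<infinity>, after (-aq;q)_n has cancelled
  against the head of the infinite product. Here \<open>a\<close> is a power series because it is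
  later replaced by \<open>a * fps_X ^ (2 * J)\<close>.\<close>

definition f_term :: "'a::field fps \<Rightarrow> nat \<Rightarrow> 'a fps" where
  "f_term a n = fps_X ^ n\<^sup>2 * a ^ n * qpoch_inf (- (a * fps_X ^ Suc n)) fps_X
     * inverse (qpoch (- fps_X) fps_X n)"

(* Found by an ansatz linear in a for the cofactor fps_X ^ n - 1 - a * fps_X ^ Suc n;
   the factor 1 + fps_X ^ n turns 1 / (-q;q)_n into 1 / (-q;q)_{n-1}, also at n = 0. *)
definition f_cert :: "'a::field fps \<Rightarrow> nat \<Rightarrow> 'a fps" where
  "f_cert a n = fps_X ^ n\<^sup>2 * a ^ n * qpoch_inf (- (a * fps_X ^ (n + 2))) fps_X
     * (fps_X ^ n - 1 - a * fps_X ^ Suc n) * (1 + fps_X ^ n)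
     * inverse (qpoch (- fps_X) fps_X n)"

text \<open>Once the infinite products are reduced to \<open>E (n + 3)\<close>, all four terms share
  the factor \<open>s * a ^ n * E (n + 3) * D\<close>. What remains is a polynomial identity in
  \<open>a\<close>, \<open>q\<close> and \<open>p = q ^ n\<close>.\<close>

lemma f_term_diff:
  fixes a :: "'a::field fps"
  shows "f_term a n - f_term (a * fps_X\<^sup>2) n = f_cert a (Suc n) - f_cert a n"
proof -
  define q where "q = (fps_X :: 'a fps)"
  define p where "p = q ^ n"
  define s where "s = q ^ n\<^sup>2"
  define E where "E k = qpoch_inf (- (a * q ^ k)) q" for k
  define D where "D = inverse (qpoch (- q) q n)"
  \<comment> \<open>A positive \<open>k\<close> makes the constant coefficient of
    \<open>a * q ^ k\<close> vanish for every \<open>a\<close>.\<close>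
  have E: "E k = (1 + a * q ^ k) * E (Suc k)" if "0 < k" for k
    using qpoch_inf_rec[of "a * fps_X ^ k"] that by (simp add: E_def q_def mult_ac)
  have E1: "E (Suc n) = (1 + a * (q * p)) * (1 + a * (q * q * p)) * E (n + 3)"
    and E2: "E (n + 2) = (1 + a * (q * q * p)) * E (n + 3)"
    using E[of "Suc n"] E[of "n + 2"]
    by (simp_all add: p_def eval_nat_numeral mult_ac)
  have 1: "f_term a n = s * a ^ n * E (Suc n) * D"
    by (simp add: f_term_def s_def E_def D_def q_def)
  have 2: "f_term (a * fps_X\<^sup>2) n = s * a ^ n * (p * p) * E (n + 3) * D"
    by (simp add: f_term_def s_def E_def D_def p_def q_def power_mult_distrib
        eval_nat_numeral mult_ac flip: power_mult power_add)
  have 4: "f_cert a n = s * a ^ n * E (n + 2) * (p - 1 - a * (q * p)) * (1 + p) * D"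
    by (simp add: f_cert_def s_def E_def D_def p_def q_def)
  have 3: "f_cert a (Suc n)
      = s * (p * p) * q * (a * a ^ n) * E (n + 3) * (q * p - 1 - a * (q * q * p)) * D"
    using inverse_qpoch_neg_X_Suc[where 'a = 'a, of n]
    by (simp add: f_cert_def s_def E_def D_def p_def q_def eval_nat_numeral
        power_add mult_ac flip: power_mult)
  have "s * A * ((1 + a * (q * p)) * (1 + a * (q * q * p)) * F) * D - s * A * (p * p) * F * D
      = s * (p * p) * q * (a * A) * F * (q * p - 1 - a * (q * q * p)) * D
        - s * A * ((1 + a * (q * q * p)) * F) * (p - 1 - a * (q * p)) * (1 + p) * D"
    for s A q p F D :: "'a fps"
    by (simp add: algebra_simps)
  then show ?thesis
    unfolding 1 2 3 4 E1 E2 .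
qed

text \<open>The lower boundary term of the telescoping sum; its factor \<open>1 + fps_X ^ 0\<close>
  is the source of the 2 in the theorem.\<close>

lemma f_cert_0: "f_cert a 0 = - (2 * a * fps_X * qpoch_inf (- (a * fps_X\<^sup>2)) fps_X)"
  by (simp add: f_cert_def qpoch_def mult_ac numeral_2_eq_2)

text \<open>The functional equation applied \<open>J\<close> times with both sums finite: no limits
  are exchanged, and the boundary terms at \<open>N\<close> stay explicit until they are discarded
  modulo \<open>fps_X ^ N\<close>.\<close>

lemma sum_f_term_iterate:
  fixes a :: "'a::field fps"
  shows "(\<Sum>n<N. f_term a n) = (\<Sum>n<N. f_term (a * fps_X ^ (2 * J)) n)
    + 2 * (\<Sum>j<J. a * fps_X ^ (2 * j + 1) * qpoch_inf (- (a * fps_X ^ (2 * j + 2))) fps_X)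
    + (\<Sum>j<J. f_cert (a * fps_X ^ (2 * j)) N)"
proof (induction J)
  case (Suc J)
  define b where "b = a * fps_X ^ (2 * J)"
  have "(\<Sum>n<N. f_term b n) - (\<Sum>n<N. f_term (b * fps_X\<^sup>2) n)
      = (\<Sum>n<N. f_cert b (Suc n) - f_cert b n)"
    by (simp add: f_term_diff flip: sum_subtractf)
  also have "\<dots> = f_cert b N - f_cert b 0"
    by (rule sum_lessThan_telescope)
  finally have "(\<Sum>n<N. f_term b n) = (\<Sum>n<N. f_term (a * fps_X ^ (2 * Suc J)) n)
      + 2 * (a * fps_X ^ (2 * J + 1) * qpoch_inf (- (a * fps_X ^ (2 * J + 2))) fps_X)
      + f_cert b N"
    by (simp add: f_cert_0 b_def algebra_simps power2_eq_square)
  with Suc show ?case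
    by (simp add: b_def algebra_simps)
qed simp

section \<open>Partitions into distinct parts\<close>

text \<open>Finite counterpart of \<open>P_do\<close>: a partition into distinct parts is identified
  with its set of parts, here bounded by \<open>M\<close>.\<close>

definition odd_min_sets :: "nat \<Rightarrow> nat set set" where
  "odd_min_sets M = {S. S \<subseteq> {1..M} \<and> S \<noteq> {} \<and> odd (Min S)}"

text \<open>Sets are sorted by their minimum \<open>2 * j + 1\<close>; the remaining elements form
  an arbitrary subset of \<open>{2 * j + 2..2 * N}\<close>, and the product expands over these
  subsets. With the even bound \<open>2 * N\<close>, the range \<open>j < N\<close> covers all odd
  minima.\<close>

lemma sum_odd_min_sets:
  fixes c x :: "'a::comm_ring_1"
  shows "(\<Sum>S\<in>odd_min_sets (2 * N). c ^ card S * x ^ \<Sum>S)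
    = (\<Sum>j<N. c * x ^ (2 * j + 1) * (\<Prod>i\<in>{2 * j + 2..2 * N}. 1 + c * x ^ i))"
proof -
  have pow: "(\<Prod>i\<in>S. c * x ^ i) = c ^ card S * x ^ \<Sum>S" for S :: "nat set"
    by (simp add: prod.distrib power_sum)
  have "(\<Sum>j<N. c * x ^ (2 * j + 1) * (\<Prod>i\<in>{2 * j + 2..2 * N}. 1 + c * x ^ i))
      = (\<Sum>j<N. \<Sum>T\<in>Pow {2 * j + 2..2 * N}. c * x ^ (2 * j + 1) * (\<Prod>i\<in>T. c * x ^ i))"
    using prod_add[of _ "\<lambda>i. c * x ^ i" "\<lambda>_. 1"] by (simp add: sum_distrib_left add.commute)
  also have "\<dots> = (\<Sum>(j, T)\<in>(SIGMA j:{..<N}. Pow {2 * j + 2..2 * N}).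
      c * x ^ (2 * j + 1) * (\<Prod>i\<in>T. c * x ^ i))"
    by (simp add: sum.Sigma)
  also have "\<dots> = (\<Sum>S\<in>odd_min_sets (2 * N). \<Prod>i\<in>S. c * x ^ i)"
  \<comment> \<open>Removing the minimum inverts its insertion; \<open>Min S div 2\<close> recovers
    \<open>j\<close> because the minimum is odd.\<close>
  proof (rule sum.reindex_bij_witness[where i = "\<lambda>S. (Min S div 2, S - {Min S})"
        and j = "\<lambda>(j, T). insert (2 * j + 1) T"], goal_cases)
    case (1 y)
    then obtain j T where y: "y = (j, T)" and T: "j < N" "T \<subseteq> {2 * j + 2..2 * N}"
      by auto
    then have "finite T" "\<And>t. t \<in> T \<Longrightarrow> 2 * j + 1 \<le> t" "2 * j + 1 \<notin> T"
      by (auto intro: finite_subset)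
    moreover from this have "Min (insert (2 * j + 1) T) = 2 * j + 1"
      by (intro Min_insert2) auto
    ultimately show ?case
      by (simp add: y)
  next
    case (2 y)
    then obtain j T where y: "y = (j, T)" and T: "j < N" "T \<subseteq> {2 * j + 2..2 * N}"
      by auto
    then have "finite T" "\<And>t. t \<in> T \<Longrightarrow> 2 * j + 1 \<le> t" "2 * j + 1 \<notin> T"
      by (auto intro: finite_subset)
    then have "Min (insert (2 * j + 1) T) = 2 * j + 1"
      by (intro Min_insert2) auto
    then show ?case
      using T by (auto simp: y odd_min_sets_def)
  next
    case (3 S)
    then have "finite S" "S \<noteq> {}"
      by (auto simp: odd_min_sets_def intro: finite_subset)
    then have "Min S \<in> S"
      by simp
    then show ?case
      using 3 by (auto simp: odd_min_sets_def)
  next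
    case (4 S)
    then have S: "finite S" "S \<noteq> {}" "S \<subseteq> {1..2 * N}" "odd (Min S)"
      by (auto simp: odd_min_sets_def intro: finite_subset)
    then have "Min S \<in> S"
      by simp
    moreover have "Min S < t" if "t \<in> S - {Min S}" for t
      using that S(1) by (simp add: order_less_le)
    moreover obtain j where j: "Min S = 2 * j + 1"
      using S(4) by (rule oddE)
    ultimately have "2 * j + 1 \<le> 2 * N" "S - {2 * j + 1} \<subseteq> {2 * j + 2..2 * N}"
      using S(3) by (auto simp: subset_iff Suc_le_eq)
    then show ?case
      by (simp add: j)
  next
    case (5 y)
    then obtain j T where y: "y = (j, T)" and T: "j < N" "T \<subseteq> {2 * j + 2..2 * N}"
      by auto
    then have "finite T" "2 * j + 1 \<notin> T"
      by (auto intro: finite_subset)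
    then show ?case
      by (simp add: y)
  qed
  finally show ?thesis
    by (simp add: pow)
qed

text \<open>A partition with a part above \<open>M\<close> has size above \<open>m\<close>, so it
  does not affect coefficient \<open>m\<close>.\<close>

lemma fps_nth_infsum_P_do:
  fixes \<alpha> :: "'a::field"
  assumes "m \<le> M"
  shows "fps_nth (\<Sum>\<^sub>\<infinity>\<nu>\<in>P_do. fps_const \<alpha> ^ size \<nu> * fps_X ^ sum_mset \<nu>) m
    = fps_nth (\<Sum>S\<in>odd_min_sets M. fps_const \<alpha> ^ card S * fps_X ^ \<Sum>S) m"
proof -
  \<comment> \<open>\<open>fps_nth_infsum\<close> asks for a finite set for every coefficient; the
    offset \<open>d\<close> makes the one for \<open>m\<close> have bound exactly
    \<open>M\<close>.\<close>
  define d where "d = M - m"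
  define B where "B k = mset_set ` odd_min_sets (k + d)" for k
  let ?f = "\<lambda>\<nu>. fps_const \<alpha> ^ size \<nu> * fps_X ^ sum_mset \<nu> :: 'a fps"
  have fin: "finite S" if "S \<in> odd_min_sets k" for S k
    using that by (auto simp: odd_min_sets_def intro: finite_subset)
  have "odd_min_sets k \<subseteq> Pow {1..k}" for k
    by (auto simp: odd_min_sets_def)
  then have "finite (odd_min_sets k)" for k
    by (rule finite_subset) simp
  then have "finite (B k)" for k
    by (simp add: B_def)
  moreover have "B k \<subseteq> P_do" for k
  proof -
    have "mset_set S \<in> P_do" if "S \<in> odd_min_sets (k + d)" for S
      using that fin[OF that]
      by (auto simp: P_do_def is_partition_def odd_min_sets_def count_mset_set' mset_set_empty_iff)
    then show ?thesis
      by (auto simp: B_def)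
  qed
  moreover have "fps_nth (?f \<nu>) k = 0" if \<nu>: "\<nu> \<in> P_do - B k" for \<nu> k
  proof -
    have eq: "\<nu> = mset_set (set_mset \<nu>)"
    proof (rule multiset_eqI)
      fix i
      have "count \<nu> i \<le> 1"
        using \<nu> by (auto simp: P_do_def)
      then show "count \<nu> i = count (mset_set (set_mset \<nu>)) i"
        by (cases "i \<in># \<nu>") (auto simp: not_in_iff le_Suc_eq simp flip: count_greater_zero_iff)
    qed
    with \<nu> have "set_mset \<nu> \<notin> odd_min_sets (k + d)"
      by (auto simp: B_def)
    with \<nu> obtain i where i: "i \<in># \<nu>" "k + d < i"
      by (force simp: P_do_def odd_min_sets_def is_partition_def subset_iff)
    then have "i \<le> sum_mset \<nu>"
      by (metis le_add1 multi_member_split sum_mset.add_mset)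
    with i show ?thesis
      by (simp add: fps_X_power_mult_right_nth)
  qed
  ultimately have "fps_nth (infsum ?f P_do) m = (\<Sum>\<nu>\<in>B m. fps_nth (?f \<nu>) m)"
    by (rule fps_nth_infsum)
  also have "\<dots> = (\<Sum>S\<in>odd_min_sets (m + d). fps_nth (?f (mset_set S)) m)"
  proof -
    have "inj_on mset_set (odd_min_sets (m + d))"
      by (rule inj_onI) (metis fin finite_set_mset_mset_set)
    then show ?thesis
      unfolding B_def by (simp add: sum.reindex)
  qed
  also have "\<dots> = (\<Sum>S\<in>odd_min_sets M. fps_nth (fps_const \<alpha> ^ card S * fps_X ^ \<Sum>S) m)"
    using assms by (auto intro!: sum.cong simp: d_def sum_unfold_sum_mset)
  finally show ?thesis
    by (simp add: fps_sum_nth)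
qed

section \<open>Assembly of the identity modulo an arbitrary power of the variable\<close>

theorem theorem5p2:
  fixes \<alpha> :: "'a::field"
  shows "qpoch_inf (- (fps_const \<alpha> * fps_X)) fps_X * f_series (fps_const \<alpha> * fps_X) fps_X =
           1 + 2 * (\<Sum>\<^sub>\<infinity>\<nu>\<in>P_do. fps_const \<alpha> ^ size \<nu> * fps_X ^ sum_mset \<nu>)"
    (is "?E * ?f = 1 + 2 * ?P")
proof (rule fps_eq_of_dvd_diff)
  fix N
  define a where "a = fps_const \<alpha>"
  define g where "g n = fps_X ^ (n\<^sup>2 - n) * (a * fps_X) ^ n
    / (qpoch (- fps_X) fps_X n * qpoch (- (a * fps_X)) fps_X n)" for n
  have qpoch_0: "fps_nth (qpoch (- (a * fps_X)) fps_X n) 0 = 1" for n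
    using fps_nth_0_prod_one_add[of "a * fps_X" n] by (simp add: qpoch_def)
  have g: "g n = fps_X ^ n\<^sup>2 * a ^ n * inverse (qpoch (- fps_X) fps_X n)
      * inverse (qpoch (- (a * fps_X)) fps_X n)" for n
  proof -
    \<comment> \<open>Ensures that the natural-number subtraction in the exponent is exact.\<close>
    have "n \<le> n\<^sup>2"
      by (simp add: power2_eq_square)
    then have "fps_X ^ (n\<^sup>2 - n) * (a * fps_X) ^ n = fps_X ^ n\<^sup>2 * a ^ n"
      by (simp add: power_mult_distrib mult_ac flip: power_add)
    then show ?thesis
      unfolding g_def
      by (subst fps_divide_unit) (simp_all add: qpoch_0 qpoch_neg_X_nth_0 fps_inverse_mult mult.assoc)
  qed
  have prod_term: "?E * g n = f_term a n" for n
  proof -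
    have "qpoch (- (a * fps_X)) fps_X n * inverse (qpoch (- (a * fps_X)) fps_X n) = 1"
      by (simp add: inverse_mult_eq_1' qpoch_0)
    then show ?thesis
      using qpoch_inf_split[of "a * fps_X" n]
      by (simp add: g f_term_def mult_ac flip: a_def)
  qed
  have small: "fps_X ^ N dvd fps_X ^ N\<^sup>2" for N
    by (simp add: le_imp_power_dvd power2_eq_square)
  have "fps_X ^ N dvd ?f - (\<Sum>n<N. g n)"
    unfolding f_series_def g_def[symmetric] a_def[symmetric]
    by (rule fps_X_power_dvd_suminf_diff) (auto simp: g small)
  from dvd_mult[OF this, of ?E]
  have "fps_X ^ N dvd ?E * ?f - (\<Sum>n<N. f_term a n)"
    by (simp add: right_diff_distrib sum_distrib_left prod_term)
  moreover have "fps_X ^ N dvd (\<Sum>n<N. f_term a n) - (1 + 2 * ?P)"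
  proof -
    \<comment> \<open>After \<open>N\<close> iterations the shifted argument vanishes modulo
      \<open>fps_X ^ N\<close>, so only the term \<open>n = 0\<close> of \<open>f_term b\<close>
      survives, and it is congruent to 1.\<close>
    define b where "b = a * fps_X ^ (2 * N)"
    define R where "R = (\<Sum>j<N. a * fps_X ^ (2 * j + 1) *
      qpoch_inf (- (a * fps_X ^ (2 * j + 2))) fps_X)"
    define Q where "Q = (\<Sum>j<N. a * fps_X ^ (2 * j + 1) *
      (\<Prod>i\<in>{2 * j + 2..2 * N}. 1 + a * fps_X ^ i))"
    have b: "fps_X ^ N dvd b"
      by (simp add: b_def le_imp_power_dvd)
    have "fps_X ^ N dvd f_term b n - of_bool (n = 0)" if "n < N" for n
    proof (cases "n = 0")
      case True
      then show ?thesis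
        using qpoch_inf_dvd_diff_one[of N "b * fps_X"] b that
        by (simp add: f_term_def qpoch_def)
    next
      case False
      then have "fps_X ^ N dvd b ^ n"
        using b by (meson dvd_power dvd_trans neq0_conv)
      then show ?thesis
        using False by (simp add: f_term_def)
    qed
    then have "fps_X ^ N dvd (\<Sum>n<N. f_term b n - of_bool (n = 0))"
      by (intro dvd_sum) simp
    \<comment> \<open>For \<open>N = 0\<close> the sum is empty, but the modulus is then 1.\<close>
    moreover have "fps_X ^ N dvd (\<Sum>n<N. of_bool (n = 0)) - (1 :: 'a fps)"
      by (cases N) (simp_all add: sum.lessThan_Suc_shift del: sum.lessThan_Suc)
    ultimately have 1: "fps_X ^ N dvd (\<Sum>n<N. f_term b n) - 1"
      unfolding sum_subtractf by (rule dvd_diff_trans)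
    have 2: "fps_X ^ N dvd (\<Sum>j<N. f_cert (a * fps_X ^ (2 * j)) N)"
      unfolding f_cert_def by (intro dvd_sum dvd_mult2 small)
    have "fps_X ^ N dvd a * fps_X ^ (2 * j + 1) * qpoch_inf (- (a * fps_X ^ (2 * j + 2))) fps_X
        - a * fps_X ^ (2 * j + 1) * (\<Prod>i\<in>{2 * j + 2..2 * N}. 1 + a * fps_X ^ i)"
      if "j < N" for j
    proof -
      define c where "c = a * fps_X ^ (2 * j + 2)"
      \<comment> \<open>\<open>K\<close> is the number of factors of the finite product. The
        prefactor \<open>fps_X ^ (2 * j + 1)\<close> raises the congruence from exponent
        \<open>K\<close> to \<open>2 * N\<close>.\<close>
      define K where "K = 2 * N - 2 * j - 1"
      have "(\<Prod>i\<in>{2 * j + 2..2 * N}. 1 + a * fps_X ^ i) = (\<Prod>i<K. 1 + c * fps_X ^ i)"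
        using that prod.shift_bounds_nat_ivl[of "\<lambda>i. 1 + a * fps_X ^ i" 0 "2 * j + 2" K]
        by (simp add: K_def c_def power_add mult_ac atLeast0LessThan
            flip: atLeastLessThanSuc_atLeastAtMost)
      moreover have "fps_X ^ K dvd qpoch_inf (- c) fps_X - (\<Prod>i<K. 1 + c * fps_X ^ i)"
        by (rule qpoch_inf_dvd_diff) (simp add: c_def)
      then have "a * fps_X ^ (2 * j + 1) * fps_X ^ K dvd
          a * fps_X ^ (2 * j + 1) * (qpoch_inf (- c) fps_X - (\<Prod>i<K. 1 + c * fps_X ^ i))"
        by (rule mult_dvd_mono[OF dvd_refl])
      moreover have "fps_X ^ N dvd a * fps_X ^ (2 * j + 1) * fps_X ^ K"
        using that by (simp only: mult.assoc flip: power_add)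
          (simp add: K_def le_imp_power_dvd)
      ultimately show ?thesis
        unfolding c_def[symmetric] right_diff_distrib[symmetric] by (simp only: dvd_trans)
    qed
    then have "fps_X ^ N dvd R - Q"
      unfolding R_def Q_def sum_subtractf[symmetric] by (intro dvd_sum) simp
    moreover have "fps_X ^ N dvd Q - ?P"
      unfolding Q_def a_def sum_odd_min_sets[symmetric]
      by (simp add: fps_X_power_dvd_iff fps_nth_infsum_P_do[of _ "2 * N"] del: fps_const_power)
    ultimately have "fps_X ^ N dvd R - ?P"
      by (rule dvd_diff_trans)
    then have "fps_X ^ N dvd ((\<Sum>n<N. f_term b n) - 1) + 2 * (R - ?P)
        + (\<Sum>j<N. f_cert (a * fps_X ^ (2 * j)) N)"
      using 1 2 by (intro dvd_add dvd_mult)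
    also have "\<dots> = (\<Sum>n<N. f_term a n) - (1 + 2 * ?P)"
      unfolding sum_f_term_iterate[of a N N] b_def[symmetric] R_def[symmetric]
      by (simp only: algebra_simps mult_2)
    finally show ?thesis .
  qed
  ultimately show "fps_X ^ N dvd ?E * ?f - (1 + 2 * ?P)"
    by (rule dvd_diff_trans)
qed

end
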